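(* Let $p$ be a prime and $D=\{1+z: z\in\mathbb{C}_p,\ |z|_p<1\}$. For every $x\in D$, $$\log(x)=\lim_{m\to\infty}\frac{1}{p^m}\left(x^{p^m}-1\right).$$
   Context: $\mathbb{C}_p$ is the field of complex $p$-adic numbers with absolute value $|\cdot|_p$. The $p$-adic logarithm $\log:D\to\mathbb{C}_p$ is defined by $\log(1+z)=\sum_{n=1}^\infty(-1)^{n-1}\frac{z^n}{n}$ for $|z|_p<1$. *)

theory Defs
  imports "HOL-Analysis.Analysis" "HOL-Computational_Algebra.Computational_Algebra"
begin

text \<open>
  The library constant \<open>norm\<close> is tied to vector spaces over the reals, so the absolute value
  is a class parameter of its own. That it is nonnegative and vanishes exactly at 0 follows
  from \<open>dist_vabs\<close> and the axioms of metric spaces.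
\<close>

class complete_valued_field = field_char_0 + complete_space +
  fixes vabs :: "'a \<Rightarrow> real"
  assumes dist_vabs: "dist x y = vabs (x - y)"
    and vabs_mult: "vabs (x * y) = vabs x * vabs y"
    and vabs_add_le_max: "vabs (x + y) \<le> max (vabs x) (vabs y)"

definition padic_abs :: "nat \<Rightarrow> rat \<Rightarrow> real" where
  "padic_abs p q = (if q = 0 then 0 else
     real p powi (int (multiplicity (int p) (snd (quotient_of q)))
                - int (multiplicity (int p) (fst (quotient_of q)))))"

text \<open>In a complete field whose absolute value extends the \<open>p\<close>-adic one on the rationals,
  the closure of the rationals is their \<open>p\<close>-adic completion.\<close>

definition padic_numbers :: "'a::complete_valued_field set" where
  "padic_numbers = closure (range of_rat)"

definition algebraic_over :: "'a::field set \<Rightarrow> 'a \<Rightarrow> bool" where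
  "algebraic_over F x \<longleftrightarrow> (\<exists>f. f \<noteq> 0 \<and> (\<forall>i. coeff f i \<in> F) \<and> poly f x = 0)"

definition algebraic_padic_numbers :: "'a::complete_valued_field set" where
  "algebraic_padic_numbers = {x. algebraic_over padic_numbers x}"

text \<open>
  The complete valued field \<open>'a\<close> is the completion of an algebraic closure of the
  completion of the rationals with respect to the \<open>p\<close>-adic absolute value. This determines
  \<open>'a\<close>, with its absolute value, up to isometric isomorphism.
\<close>

definition is_complex_padic_field :: "nat \<Rightarrow> 'a::complete_valued_field itself \<Rightarrow> bool" where
  "is_complex_padic_field p T \<longleftrightarrow>
     (\<forall>q. vabs (of_rat q :: 'a) = padic_abs p q) \<and>
     (\<forall>f :: 'a poly. degree f > 0 \<and> (\<forall>i. coeff f i \<in> algebraic_padic_numbers) \<longrightarrow>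
        (\<exists>x \<in> algebraic_padic_numbers. poly f x = 0)) \<and>
     closure (algebraic_padic_numbers :: 'a set) = UNIV"

definition padic_log_domain :: "'a::complete_valued_field set" where
  "padic_log_domain = {1 + z | z. vabs z < 1}"

text \<open>The summation index is shifted by one, so that the series starts at \<open>n = 0\<close>.\<close>

definition padic_log :: "'a::complete_valued_field \<Rightarrow> 'a" where
  "padic_log x = (\<Sum>n. (-1) ^ n * (x - 1) ^ Suc n / of_nat (Suc n))"

end

theory Submission
  imports Defs
begin

text \<open>
  Put \<open>z = x - 1\<close> and \<open>N = p ^ m\<close>. The binomial theorem and the absorption identity
  \<open>(j+1) C(N, j+1) = N C(N-1, j)\<close> give
  \<open>(x^N - 1) / N = (\<Sum>j<N. C(N-1, j) z^(j+1) / (j+1))\<close>,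
  while the \<open>N\<close>-th partial sum of the logarithm series is the same expression with \<open>(-1)^j\<close>
  in place of \<open>C(N-1, j)\<close>. The two sets of coefficients are \<open>p\<close>-adically close: by Pascal's rule
  \<open>C(N-1, j+1) + C(N-1, j) = C(N, j+1)\<close> is divisible by \<open>N\<close> up to the denominator \<open>j+1\<close>, whose
  inverse has absolute value at most \<open>j+1\<close>, so that
  \<open>|C(N-1, j) - (-1)^j| \<le> j |N|\<close> (lemma \<open>vabs_binomial_pred_minus_sign_le\<close>).

  By the ultrametric inequality the two sums therefore differ by at most
  \<open>p^(-m) sup_j (j+1)^2 |z|^(j+1)\<close>, and the supremum is finite because \<open>|z| < 1\<close>. As the
  partial sums converge to the logarithm, so do the quotients on the left.
\<close>

section \<open>Ultrametric absolute values\<close>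

context complete_valued_field
begin

lemma vabs_0 [simp]: "vabs 0 = 0"
  using dist_vabs[of 0 0] by simp

lemma vabs_eq_0_iff [simp]: "vabs a = 0 \<longleftrightarrow> a = 0"
  using dist_vabs[of a 0] by (metis diff_zero dist_eq_0_iff)

lemma vabs_nonneg [simp]: "0 \<le> vabs a"
  using dist_vabs[of a 0] by (metis diff_zero zero_le_dist)

lemma vabs_1 [simp]: "vabs 1 = 1"
  using vabs_mult[of 1 1] by auto

lemma vabs_minus [simp]: "vabs (- a) = vabs a"
  by (metis diff_0 diff_zero dist_commute dist_vabs)

lemma vabs_power: "vabs (a ^ n) = vabs a ^ n"
  by (induction n) (simp_all add: vabs_mult)

lemma vabs_of_nat_le_1: "vabs (of_nat n) \<le> 1"
proof (induction n)
  case (Suc n)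
  then show ?case
    using vabs_add_le_max[of 1 "of_nat n"] by simp
qed simp

lemma vabs_sum_le:
  assumes "\<And>i. i \<in> A \<Longrightarrow> vabs (f i) \<le> e" and "0 \<le> e"
  shows "vabs (sum f A) \<le> e"
  using assms
proof (induction A rule: infinite_finite_induct)
  case (insert i A)
  then have "max (vabs (f i)) (vabs (sum f A)) \<le> e"
    by simp
  then have "vabs (f i + sum f A) \<le> e"
    using vabs_add_le_max order_trans by blast
  with insert.hyps show ?case
    by simp
qed simp_all

end

lemma vabs_divide: "vabs (a / b) = vabs a / vabs (b :: 'a::complete_valued_field)"
proof (cases "b = 0")
  case False
  then have "vabs (a / b) * vabs b = vabs a"
    by (simp flip: vabs_mult)
  with False show ?thesis
    by (simp add: eq_divide_eq)
qed simp

lemma tendsto_of_vabs_diff: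
  fixes f g :: "'b \<Rightarrow> 'a::complete_valued_field"
  assumes "(g \<longlongrightarrow> l) F" and "((\<lambda>i. vabs (f i - g i)) \<longlongrightarrow> 0) F"
  shows "(f \<longlongrightarrow> l) F"
proof (rule metric_tendsto_imp_tendsto)
  show "((\<lambda>i. dist (g i) l + vabs (f i - g i)) \<longlongrightarrow> 0) F"
    using tendsto_add[OF assms(1)[THEN tendsto_dist_iff[THEN iffD1]] assms(2)] by simp
  show "\<forall>\<^sub>F i in F. dist (f i) l \<le> dist (dist (g i) l + vabs (f i - g i)) 0"
    using dist_triangle[of "f _" l "g _"]
    by (intro always_eventually allI) (simp add: dist_vabs[symmetric] add.commute)
qed

text \<open>
  In contrast to real series, terms tending to 0 suffice: a block of terms is no larger than its
  largest member, so the partial sums form a Cauchy sequence.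
\<close>

lemma ultrametric_summable:
  fixes f :: "nat \<Rightarrow> 'a::complete_valued_field"
  assumes "(\<lambda>n. vabs (f n)) \<longlonglongrightarrow> 0"
  shows "summable f"
proof -
  have "Cauchy (\<lambda>n. \<Sum>i<n. f i)"
    unfolding Cauchy_altdef
  proof (intro allI impI)
    fix e :: real
    assume "0 < e"
    then have "\<forall>\<^sub>F n in sequentially. vabs (f n) < e / 2"
      using assms by (intro order_tendstoD(2)) auto
    then obtain M where M: "\<And>n. n \<ge> M \<Longrightarrow> vabs (f n) < e / 2"
      by (auto simp: eventually_sequentially)
    show "\<exists>M. \<forall>m\<ge>M. \<forall>n>m. dist (\<Sum>i<m. f i) (\<Sum>i<n. f i) < e"
    proof (intro exI[of _ M] allI impI)
      fix m n
      assume "M \<le> m" "m < n"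
      have "dist (\<Sum>i<m. f i) (\<Sum>i<n. f i) = vabs ((\<Sum>i<n. f i) - (\<Sum>i<m. f i))"
        by (metis dist_commute dist_vabs)
      also have "\<dots> = vabs (sum f {m..<n})"
        using sum_diff_nat_ivl[of 0 m n f] \<open>m < n\<close> by (simp add: lessThan_atLeast0)
      also have "\<dots> \<le> e / 2"
        using M \<open>M \<le> m\<close> \<open>0 < e\<close> by (intro vabs_sum_le) (auto intro: less_imp_le)
      finally show "dist (\<Sum>i<m. f i) (\<Sum>i<n. f i) < e"
        using \<open>0 < e\<close> by simp
    qed
  qed
  then show ?thesis
    by (simp add: summable_iff_convergent Cauchy_convergent)
qed

section \<open>The absolute value of natural numbers\<close>

lemma padic_abs_of_nat:
  "padic_abs p (of_nat n) = (if n = 0 then 0 else 1 / real p ^ multiplicity p n)"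
proof -
  have "multiplicity (int p) (int n) = multiplicity p n"
    by (simp add: multiplicity_def flip: of_nat_power)
  then show ?thesis
    by (simp add: padic_abs_def power_int_minus inverse_eq_divide)
qed

lemma vabs_of_nat:
  assumes "is_complex_padic_field p TYPE('a::complete_valued_field)"
  shows "vabs (of_nat n :: 'a) = padic_abs p (of_nat n)"
  using assms unfolding is_complex_padic_field_def by (metis of_rat_of_nat_eq)

lemma vabs_prime_power:
  assumes "prime p" and "is_complex_padic_field p TYPE('a::complete_valued_field)"
  shows "vabs (of_nat (p ^ m) :: 'a) = 1 / real p ^ m"
  using assms(1) vabs_of_nat[OF assms(2), of "p ^ m"]
  by (simp add: padic_abs_of_nat prime_gt_0_nat del: of_nat_power)

text \<open>
  The denominators of the logarithm series are small only to the extent that they contain a large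
  power of \<open>p\<close>, and such a power cannot exceed the number that it divides.
\<close>

lemma inverse_vabs_of_nat_le:
  assumes "is_complex_padic_field p TYPE('a::complete_valued_field)" and "n > 0"
  shows "1 / vabs (of_nat n :: 'a) \<le> real n"
proof -
  have "p ^ multiplicity p n \<le> n"
    using \<open>n > 0\<close> by (intro dvd_imp_le multiplicity_dvd)
  then have "real p ^ multiplicity p n \<le> real n"
    by (metis of_nat_le_iff of_nat_power)
  then show ?thesis
    using \<open>n > 0\<close> by (simp add: vabs_of_nat[OF assms(1)] padic_abs_of_nat)
qed

section \<open>Comparison of the coefficients\<close>

text \<open>
  Modulo \<open>p ^ m\<close> one has \<open>C(p^m - 1, j) = C(-1, j) = (-1)^j\<close>, up to the loss caused by
  denominators. Each step of Pascal's rule contributes an error of at most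
  \<open>(j+1) |p ^ m|\<close>; the ultrametric inequality keeps the largest of these, not their sum.
\<close>

lemma vabs_binomial_pred_minus_sign_le:
  assumes "prime p" and "is_complex_padic_field p TYPE('a::complete_valued_field)"
  shows "vabs (of_nat ((p ^ m - 1) choose j) - (-1) ^ j :: 'a) \<le> real j / real p ^ m"
proof (induction j)
  case (Suc j)
  define N where "N = p ^ m"
  have "N > 0"
    using assms(1) by (simp add: N_def prime_gt_0_nat)
  then have pascal: "N choose Suc j = ((N - 1) choose j) + ((N - 1) choose Suc j)"
    by (cases N) simp_all
  have absorb: "Suc j * (N choose Suc j) = N * ((N - 1) choose j)"
    by (rule binomial_absorption)
  have "(of_nat (Suc j) * of_nat (N choose Suc j) :: 'a) = of_nat N * of_nat ((N - 1) choose j)"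
    using absorb by (metis of_nat_mult)
  then have "(of_nat (N choose Suc j) :: 'a) = of_nat N * of_nat ((N - 1) choose j) / of_nat (Suc j)"
    by (simp add: eq_divide_eq mult.commute del: of_nat_Suc)
  then have "vabs (of_nat (N choose Suc j) :: 'a)
      = vabs (of_nat ((N - 1) choose j) :: 'a) * (1 / vabs (of_nat (Suc j) :: 'a)) / real p ^ m"
    using vabs_prime_power[OF assms, of m]
    by (simp add: vabs_mult vabs_divide N_def del: of_nat_Suc of_nat_power)
  also have "\<dots> \<le> 1 * real (Suc j) / real p ^ m"
    by (intro divide_right_mono mult_mono vabs_of_nat_le_1 inverse_vabs_of_nat_le[OF assms(2)])
      simp_all
  finally have step: "vabs (of_nat (N choose Suc j) :: 'a) \<le> real (Suc j) / real p ^ m"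
    by simp
  have "of_nat ((N - 1) choose Suc j) - (-1) ^ Suc j
      = of_nat (N choose Suc j) + - (of_nat ((N - 1) choose j) - (-1) ^ j :: 'a)"
    by (simp add: pascal)
  then have "vabs (of_nat ((N - 1) choose Suc j) - (-1) ^ Suc j :: 'a)
      \<le> max (vabs (of_nat (N choose Suc j) :: 'a))
            (vabs (of_nat ((N - 1) choose j) - (-1) ^ j :: 'a))"
    by (metis vabs_add_le_max vabs_minus)
  also have "\<dots> \<le> real (Suc j) / real p ^ m"
  proof (rule max.boundedI[OF step])
    have "real j / real p ^ m \<le> real (Suc j) / real p ^ m"
      by (intro divide_right_mono) simp_all
    with Suc.IH show "vabs (of_nat ((N - 1) choose j) - (-1) ^ j :: 'a) \<le> real (Suc j) / real p ^ m"
      by (simp add: N_def)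
  qed
  finally show ?case
    by (simp add: N_def)
qed simp

lemma binomial_difference_quotient:
  fixes z :: "'a::field_char_0"
  assumes "N > 0"
  shows "((1 + z) ^ N - 1) / of_nat N
    = (\<Sum>j<N. of_nat ((N - 1) choose j) * z ^ Suc j / of_nat (Suc j))"
proof -
  have coeff: "of_nat (N choose Suc j) / of_nat N
      = (of_nat ((N - 1) choose j) / of_nat (Suc j) :: 'a)" for j
  proof -
    have "Suc j * (N choose Suc j) = N * ((N - 1) choose j)"
      by (rule binomial_absorption)
    then have "of_nat (Suc j) * of_nat (N choose Suc j)
        = (of_nat N * of_nat ((N - 1) choose j) :: 'a)"
      by (metis of_nat_mult)
    then show ?thesis
      using assms by (simp add: frac_eq_eq mult.commute del: of_nat_Suc)
  qed
  have "(1 + z) ^ N = (\<Sum>k\<le>N. of_nat (N choose k) * z ^ k)"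
    using binomial_ring[of z 1 N] by (simp add: add.commute)
  also have "\<dots> = 1 + (\<Sum>j<N. of_nat (N choose Suc j) * z ^ Suc j)"
    by (simp only: sum.atMost_shift) simp
  finally have "((1 + z) ^ N - 1) / of_nat N
      = (\<Sum>j<N. of_nat (N choose Suc j) / of_nat N * z ^ Suc j)"
    by (simp add: sum_divide_distrib)
  also have "\<dots> = (\<Sum>j<N. of_nat ((N - 1) choose j) * z ^ Suc j / of_nat (Suc j))"
    by (simp only: coeff times_divide_eq_left)
  finally show ?thesis .
qed

section \<open>Convergence\<close>

lemma square_times_power_tendsto_0:
  fixes r :: real
  assumes "0 \<le> r" and "r < 1"
  shows "(\<lambda>n. real n ^ 2 * r ^ n) \<longlonglongrightarrow> 0"
proof -
  \<comment> \<open>The claim is the square of the corresponding limit for \<open>n * sqrt r ^ n\<close>.\<close>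
  have "(\<lambda>n. of_nat n * sqrt r ^ n) \<longlonglongrightarrow> 0"
    using assms by (intro powser_times_n_limit_0) (simp add: real_sqrt_lt_1_iff)
  then have "(\<lambda>n. (of_nat n * sqrt r ^ n) ^ 2) \<longlonglongrightarrow> 0 ^ 2"
    by (rule tendsto_power)
  moreover have "(of_nat n * sqrt r ^ n) ^ 2 = real n ^ 2 * r ^ n" for n
    using assms by (simp add: power_mult_distrib flip: power_mult)
      (simp add: mult.commute[of n] power_mult)
  ultimately show ?thesis
    by simp
qed

text \<open>
  Dividing by \<open>n\<close> multiplies the absolute value by at most \<open>n\<close>, which the geometric decay of
  \<open>|z|^n\<close> absorbs; hence the terms of the logarithm series tend to 0.
\<close>

lemma padic_log_sums:
  fixes z :: "'a::complete_valued_field"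
  assumes "is_complex_padic_field p TYPE('a)" and "vabs z < 1"
  shows "(\<lambda>n. (-1) ^ n * z ^ Suc n / of_nat (Suc n)) sums padic_log (1 + z)"
proof -
  have "(\<lambda>n. real (Suc n) * vabs z ^ Suc n) \<longlonglongrightarrow> 0"
    using powser_times_n_limit_0[of "vabs z"] assms(2) by (intro LIMSEQ_Suc) simp
  then have "(\<lambda>n. vabs ((-1) ^ n * z ^ Suc n / of_nat (Suc n))) \<longlonglongrightarrow> 0"
  proof (rule Lim_null_comparison[rotated], intro always_eventually allI)
    fix n
    have "vabs ((-1) ^ n * z ^ Suc n / of_nat (Suc n))
        = 1 / vabs (of_nat (Suc n) :: 'a) * vabs z ^ Suc n"
      by (simp add: vabs_divide vabs_mult vabs_power del: of_nat_Suc)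
    also have "\<dots> \<le> real (Suc n) * vabs z ^ Suc n"
      by (intro mult_right_mono inverse_vabs_of_nat_le[OF assms(1)]) simp_all
    finally show "norm (vabs ((-1) ^ n * z ^ Suc n / of_nat (Suc n))) \<le> real (Suc n) * vabs z ^ Suc n"
      by simp
  qed
  then have "summable (\<lambda>n. (-1) ^ n * z ^ Suc n / of_nat (Suc n))"
    by (rule ultrametric_summable)
  then show ?thesis
    by (simp add: padic_log_def summable_sums)
qed

theorem corollary3p12:
  fixes p :: nat and x :: "'a::complete_valued_field"
  assumes "prime p"
    and "is_complex_padic_field p TYPE('a)"
    and "x \<in> padic_log_domain"
  shows "(\<lambda>m. 1 / of_nat (p ^ m) * (x ^ (p ^ m) - 1)) \<longlonglongrightarrow> padic_log x"
proof -
  note field = assms(1,2)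
  obtain z where x: "x = 1 + z" and z: "vabs z < 1"
    using assms(3) by (auto simp: padic_log_domain_def)
  define S where "S = (\<lambda>n. \<Sum>j<n. (-1) ^ j * z ^ Suc j / of_nat (Suc j))"
  have p: "p > 1"
    using assms(1) by (rule prime_gt_1_nat)
  have "S \<longlonglongrightarrow> padic_log x"
    using padic_log_sums[OF assms(2) z] by (simp add: sums_def S_def x)
  then have partial: "(\<lambda>m. S (p ^ m)) \<longlonglongrightarrow> padic_log x"
    using LIMSEQ_subseq_LIMSEQ[of S _ "\<lambda>m. p ^ m"] p
    by (simp add: strict_mono_def power_strict_increasing o_def)
  \<comment> \<open>One factor \<open>n\<close> stems from the error of the coefficients, the other from the denominators.\<close>
  obtain B where B: "B > 0" "\<And>n. real n ^ 2 * vabs z ^ n \<le> B"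
  proof -
    have "Bseq (\<lambda>n. real n ^ 2 * vabs z ^ n)"
      using square_times_power_tendsto_0[of "vabs z"] z
      by (intro convergent_imp_Bseq) (auto simp: convergent_def)
    then show thesis
      using that by (auto simp: Bseq_def abs_le_iff)
  qed
  have close: "vabs (1 / of_nat (p ^ m) * (x ^ (p ^ m) - 1) - S (p ^ m)) \<le> B / real p ^ m" for m
  proof -
    define c where "c j = (of_nat ((p ^ m - 1) choose j) - (-1) ^ j :: 'a)" for j
    have "1 / of_nat (p ^ m) * (x ^ (p ^ m) - 1) - S (p ^ m)
        = (\<Sum>j<p ^ m. c j * z ^ Suc j / of_nat (Suc j))"
      using binomial_difference_quotient[of "p ^ m" z] p
      by (simp add: x S_def c_def sum_subtractf left_diff_distrib diff_divide_distrib
          del: of_nat_Suc of_nat_power power_Suc)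
    also have "vabs \<dots> \<le> B / real p ^ m"
    proof (rule vabs_sum_le)
      fix j
      have "vabs (c j * z ^ Suc j / of_nat (Suc j))
          = vabs (c j) * (1 / vabs (of_nat (Suc j) :: 'a)) * vabs z ^ Suc j"
        by (simp add: vabs_divide vabs_mult vabs_power del: of_nat_Suc)
      also have "\<dots> \<le> real (Suc j) / real p ^ m * real (Suc j) * vabs z ^ Suc j"
      proof (intro mult_right_mono mult_mono)
        have "vabs (c j) \<le> real j / real p ^ m"
          unfolding c_def by (rule vabs_binomial_pred_minus_sign_le[OF field])
        also have "\<dots> \<le> real (Suc j) / real p ^ m"
          by (intro divide_right_mono) simp_all
        finally show "vabs (c j) \<le> real (Suc j) / real p ^ m" .
      qed (simp_all add: inverse_vabs_of_nat_le[OF assms(2)] del: of_nat_Suc)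
      also have "\<dots> = real (Suc j) ^ 2 * vabs z ^ Suc j / real p ^ m"
        by (simp add: power2_eq_square del: of_nat_Suc power_Suc)
      also have "\<dots> \<le> B / real p ^ m"
        by (intro divide_right_mono B) simp
      finally show "vabs (c j * z ^ Suc j / of_nat (Suc j)) \<le> B / real p ^ m" .
    qed (use B in simp)
    finally show ?thesis .
  qed
  have "(\<lambda>m. B / real p ^ m) \<longlonglongrightarrow> 0"
    using p by (intro LIMSEQ_divide_realpow_zero) simp
  then have "(\<lambda>m. vabs (1 / of_nat (p ^ m) * (x ^ (p ^ m) - 1) - S (p ^ m))) \<longlonglongrightarrow> 0"
    by (rule Lim_null_comparison[rotated])
      (use close in \<open>simp del: of_nat_power\<close>)
  with partial show ?thesis
    by (rule tendsto_of_vabs_diff)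
qed

end
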